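(* Let $(X_i)_{i\ge 1}$ be a sequence of independent random variables, each uniformly distributed on $(0,1)$. For any fixed integer $k \ge 1$, almost surely, $$\frac{\sigma_k^{(n)}}{\bigl(S_1^{(n)}\bigr)^k} \longrightarrow \frac{1}{k!} \quad \text{as } n \to \infty,$$ where $$\sigma_k^{(n)} = \sum_{1 \le i_1 < \dots < i_k \le n} X_{i_1} \cdots X_{i_k}, \qquad S_1^{(n)} = \sum_{i=1}^n X_i.$$
   Context: $\sigma_k^{(n)}$ is the $k$-th elementary symmetric polynomial evaluated at $X_1,\dots,X_n$, and $S_1^{(n)}$ is the first power sum of $X_1,\dots,X_n$. *)

theory Defs
  imports "HOL-Probability.Probability"
begin

text \<open>
  The \<open>k\<close>-element subsets of \<open>{1..n}\<close> encode the index tuples \<open>i\<^sub>1 < \<dots> < i\<^sub>k\<close>;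
  \<open>elem_sym_strictly_increasing\<close> below is the sum over the tuples themselves.
\<close>

definition elem_sym :: "nat \<Rightarrow> nat \<Rightarrow> (nat \<Rightarrow> 'a::comm_semiring_1) \<Rightarrow> 'a"
  where "elem_sym k n x = (\<Sum>A | A \<subseteq> {1..n} \<and> card A = k. \<Prod>i\<in>A. x i)"

lemma elem_sym_strictly_increasing:
  "elem_sym k n x =
    (\<Sum>js | length js = k \<and> sorted_wrt (<) js \<and> set js \<subseteq> {1..n}. \<Prod>i\<leftarrow>js. x i)"
  unfolding elem_sym_def
proof (rule sum.reindex_bij_witness[where i = set and j = sorted_list_of_set])
  fix A assume A: "A \<in> {A. A \<subseteq> {1..n} \<and> card A = k}"
  then have fin: "finite A"
    using finite_subset by blast
  then show "set (sorted_list_of_set A) = A"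
    by simp
  show "sorted_list_of_set A \<in> {js. length js = k \<and> sorted_wrt (<) js \<and> set js \<subseteq> {1..n}}"
    using A fin by simp
  show "(\<Prod>i\<leftarrow>sorted_list_of_set A. x i) = (\<Prod>i\<in>A. x i)"
    using fin prod.distinct_set_conv_list[of "sorted_list_of_set A" x] by simp
next
  fix js assume "js \<in> {js. length js = k \<and> sorted_wrt (<) js \<and> set js \<subseteq> {1..n}}"
  then show "sorted_list_of_set (set js) = js" "set js \<in> {A. A \<subseteq> {1..n} \<and> card A = k}"
    by (auto simp: strict_sorted_iff distinct_card sorted_list_of_set.idem_if_sorted_distinct)
qed

end

theory Submission
  imports Defs
begin

text \<open>
  Expanding \<open>S\<^sub>1\<^sup>k\<close> produces every product over \<open>k\<close> distinct indices \<open>k!\<close> times, together with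
  products in which an index is repeated. Since the variables lie in \<open>[0, 1]\<close>, dropping one
  repeated factor only enlarges such a product, so the repetitions contribute at most a multiple of
  \<open>S\<^sub>1\<^bsup>k-1\<^esup>\<close>, which is negligible as soon as \<open>S\<^sub>1\<close> diverges. This makes the limit a
  deterministic fact about sequences in \<open>[0, 1]\<close> with divergent sum
  (\<open>elem_sym_div_sum_power_tendsto\<close>). It is proved by induction on \<open>k\<close>, multiplying by one further
  factor \<open>S\<^sub>1\<close> at a time: \<open>elem_sym_Suc_bounds\<close> says that \<open>\<sigma>\<^sub>k S\<^sub>1\<close> and \<open>(k + 1) \<sigma>\<^sub>k\<^sub>+\<^sub>1\<close> differ by at
  most \<open>k \<sigma>\<^sub>k\<close>.

  The probabilistic input is that the partial sums diverge almost surely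
  (\<open>AE_sum_indep_at_top\<close>). By independence the expectation of \<open>exp (- S\<^sub>1)\<close> is the product of the
  expectations of \<open>exp (- X\<^sub>i)\<close>, hence decays geometrically in \<open>n\<close>; so \<open>exp (- S\<^sub>1)\<close> is almost
  surely summable over \<open>n\<close> and in particular tends to \<open>0\<close>.
\<close>

text \<open>
  In the product on the left, a \<open>k\<close>-subset \<open>A\<close> meets an index \<open>i\<close>. If \<open>i \<notin> A\<close>, then \<open>insert i A\<close> is
  a \<open>(k + 1)\<close>-subset, and each of these arises once for each of its \<open>k + 1\<close> elements; the pairs
  with \<open>i \<in> A\<close> make up the remaining sum.
\<close>

lemma sum_times_elem_sym:
  fixes x :: "nat \<Rightarrow> 'a::comm_semiring_1"
  shows "elem_sym k n x * (\<Sum>i=1..n. x i) =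
    of_nat (Suc k) * elem_sym (Suc k) n x +
    (\<Sum>A | A \<subseteq> {1..n} \<and> card A = k. (\<Sum>i\<in>A. x i) * (\<Prod>i\<in>A. x i))"
proof -
  define F where "F k = {A. A \<subseteq> {1..n} \<and> card A = k}" for k
  have finF: "finite (F k)" for k
    unfolding F_def by simp
  have fin: "finite A" if "A \<in> F k" for A k
    using that finite_subset unfolding F_def by blast
  have split: "(\<Sum>i=1..n. x i) = (\<Sum>i\<in>{1..n} - A. x i) + (\<Sum>i\<in>A. x i)"
    if "A \<in> F k" for A k
    using that by (intro sum.subset_diff) (auto simp: F_def)
  have "(\<Sum>A\<in>F k. (\<Prod>i\<in>A. x i) * (\<Sum>i\<in>{1..n} - A. x i)) =
      (\<Sum>(A, i)\<in>(SIGMA A:F k. {1..n} - A). \<Prod>j\<in>insert i A. x j)"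
    using fin
    by (subst sum.Sigma[symmetric])
       (auto simp: finF sum_distrib_left mult.commute intro!: sum.cong)
  also have "\<dots> = (\<Sum>(B, i)\<in>(SIGMA B:F (Suc k). B). \<Prod>j\<in>B. x j)"
    by (rule sum.reindex_bij_witness
        [where i = "\<lambda>(B, i). (B - {i}, i)" and j = "\<lambda>(A, i). (insert i A, i)"])
       (auto simp: F_def card_insert_if finite_subset insert_absorb)
  also have "\<dots> = (\<Sum>B\<in>F (Suc k). of_nat (Suc k) * (\<Prod>j\<in>B. x j))"
    using fin
    by (subst sum.Sigma[symmetric]) (auto simp: finF F_def intro!: sum.cong)
  finally have grow: "(\<Sum>A\<in>F k. (\<Prod>i\<in>A. x i) * (\<Sum>i\<in>{1..n} - A. x i)) =
      of_nat (Suc k) * (\<Sum>B\<in>F (Suc k). \<Prod>j\<in>B. x j)"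
    by (simp only: sum_distrib_left)
  have "(\<Sum>A\<in>F k. \<Prod>i\<in>A. x i) * (\<Sum>i=1..n. x i) =
      (\<Sum>A\<in>F k. (\<Prod>i\<in>A. x i) * (\<Sum>i\<in>{1..n} - A. x i) + (\<Sum>i\<in>A. x i) * (\<Prod>i\<in>A. x i))"
    unfolding sum_distrib_right[where A = "F k"]
    by (intro sum.cong refl) (simp only: split distrib_left mult.commute)
  then show ?thesis
    using grow unfolding elem_sym_def F_def[symmetric] by (simp add: sum.distrib)
qed

text \<open>
  The remainder in \<open>sum_times_elem_sym\<close> lies between \<open>0\<close> and \<open>k\<close> times \<open>elem_sym k n x\<close>, because
  \<open>k\<close> entries from \<open>[0, 1]\<close> add up to at most \<open>k\<close>.
\<close>

lemma elem_sym_Suc_bounds: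
  fixes x :: "nat \<Rightarrow> real"
  assumes "\<And>i. i \<ge> 1 \<Longrightarrow> 0 \<le> x i" and "\<And>i. i \<ge> 1 \<Longrightarrow> x i \<le> 1"
  shows "real (Suc k) * elem_sym (Suc k) n x \<le> elem_sym k n x * (\<Sum>i=1..n. x i)"
    and "elem_sym k n x * ((\<Sum>i=1..n. x i) - real k) \<le> real (Suc k) * elem_sym (Suc k) n x"
proof -
  let ?R = "\<Sum>A | A \<subseteq> {1..n} \<and> card A = k. (\<Sum>i\<in>A. x i) * (\<Prod>i\<in>A. x i)"
  have bounds: "0 \<le> (\<Sum>i\<in>A. x i)" "(\<Sum>i\<in>A. x i) \<le> real k" "0 \<le> (\<Prod>i\<in>A. x i)"
    if "A \<subseteq> {1..n}" "card A = k" for A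
  proof -
    have pos: "i \<ge> 1" if "i \<in> A" for i
      using that \<open>A \<subseteq> {1..n}\<close> by auto
    show "0 \<le> (\<Sum>i\<in>A. x i)" "0 \<le> (\<Prod>i\<in>A. x i)"
      using pos assms(1) by (auto intro!: sum_nonneg prod_nonneg)
    show "(\<Sum>i\<in>A. x i) \<le> real k"
      using sum_bounded_above[of A x 1] pos assms(2) \<open>card A = k\<close> by simp
  qed
  have "0 \<le> ?R"
    using bounds by (intro sum_nonneg) auto
  moreover have "?R \<le> real k * elem_sym k n x"
    unfolding elem_sym_def sum_distrib_left
    using bounds by (intro sum_mono mult_right_mono) auto
  ultimately show
    "real (Suc k) * elem_sym (Suc k) n x \<le> elem_sym k n x * (\<Sum>i=1..n. x i)"
    "elem_sym k n x * ((\<Sum>i=1..n. x i) - real k) \<le> real (Suc k) * elem_sym (Suc k) n x"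
    using sum_times_elem_sym[of k n x] by (simp_all add: algebra_simps)
qed

text \<open>
  Dividing \<open>elem_sym_Suc_bounds\<close> by \<open>(k + 1) S\<^bsup>k+1\<^esup>\<close> squeezes the ratio for \<open>k + 1\<close> between the
  ratio for \<open>k\<close> divided by \<open>k + 1\<close> and the same quantity times \<open>1 - k / S\<close>.
\<close>

lemma elem_sym_div_sum_power_tendsto:
  fixes x :: "nat \<Rightarrow> real"
  assumes "\<And>i. i \<ge> 1 \<Longrightarrow> 0 \<le> x i" and "\<And>i. i \<ge> 1 \<Longrightarrow> x i \<le> 1"
    and div: "filterlim (\<lambda>n. \<Sum>i=1..n. x i) at_top sequentially"
  shows "(\<lambda>n. elem_sym k n x / (\<Sum>i=1..n. x i) ^ k) \<longlonglongrightarrow> 1 / fact k"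
proof (induction k)
  case 0
  have "{A::nat set. A \<subseteq> {1..n} \<and> card A = 0} = {{}}" for n
    by (auto dest: finite_subset)
  then show ?case
    by (simp add: elem_sym_def)
next
  case (Suc k)
  define S where "S n = (\<Sum>i=1..n. x i)" for n
  define r where "r k n = elem_sym k n x / S n ^ k" for k n
  have S: "filterlim S at_top sequentially"
    using div unfolding S_def .
  then have pos: "eventually (\<lambda>n. S n > 0) sequentially"
    by (rule filterlim_at_top_dense[THEN iffD1, rule_format])
  have IH: "r k \<longlonglongrightarrow> 1 / fact k"
    using Suc.IH unfolding r_def S_def .
  have lim: "(\<lambda>n. real k / S n) \<longlonglongrightarrow> 0"
    by (rule real_tendsto_divide_at_top[OF tendsto_const S])
  have "r (Suc k) \<longlonglongrightarrow> 1 / fact k / real (Suc k)"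
  proof (rule tendsto_sandwich)
    show "eventually (\<lambda>n. r (Suc k) n \<le> r k n / real (Suc k)) sequentially"
      using pos
    proof eventually_elim
      case (elim n)
      have "r (Suc k) n = real (Suc k) * elem_sym (Suc k) n x / (real (Suc k) * S n ^ Suc k)"
        by (simp add: r_def)
      also have "\<dots> \<le> elem_sym k n x * S n / (real (Suc k) * S n ^ Suc k)"
        using elem_sym_Suc_bounds(1)[of x k n] assms elim
        by (intro divide_right_mono) (auto simp: S_def)
      also have "\<dots> = r k n / real (Suc k)"
        using elim by (simp add: r_def)
      finally show ?case .
    qed
    show "eventually (\<lambda>n. r k n * (1 - real k / S n) / real (Suc k) \<le> r (Suc k) n) sequentially"
      using pos
    proof eventually_elim
      case (elim n)
      have "r k n * (1 - real k / S n) / real (Suc k) =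
          elem_sym k n x * (S n - real k) / (real (Suc k) * S n ^ Suc k)"
        using elim by (simp add: r_def field_simps)
      also have "\<dots> \<le> real (Suc k) * elem_sym (Suc k) n x / (real (Suc k) * S n ^ Suc k)"
        using elem_sym_Suc_bounds(2)[of x k n] assms elim
        by (intro divide_right_mono) (auto simp: S_def)
      finally show ?case
        by (simp add: r_def)
    qed
    show "(\<lambda>n. r k n / real (Suc k)) \<longlonglongrightarrow> 1 / fact k / real (Suc k)"
      by (intro tendsto_divide IH tendsto_const) simp
    have "(\<lambda>n. r k n * (1 - real k / S n) / real (Suc k)) \<longlonglongrightarrow> 1 / fact k * (1 - 0) / real (Suc k)"
      by (intro tendsto_intros IH lim) simp
    then show "(\<lambda>n. r k n * (1 - real k / S n) / real (Suc k)) \<longlonglongrightarrow> 1 / fact k / real (Suc k)"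
      by simp
  qed
  then show ?case
    by (simp add: r_def[abs_def] S_def mult.commute)
qed

text \<open>
  The exponential turns a sum into a product, so independence bounds the expectation of
  \<open>exp (- S\<^sub>n)\<close>, with \<open>S\<^sub>n\<close> the \<open>n\<close>-th partial sum, by \<open>q\<^sup>n\<close>. A nonnegative series whose
  expectation is finite converges almost surely, so its terms tend to \<open>0\<close>. Summing over \<open>n\<close> in
  this way yields divergence of the whole sequence even if the \<open>S\<^sub>n\<close> are not monotone.
\<close>

lemma (in prob_space) AE_sum_indep_at_top:
  fixes X :: "nat \<Rightarrow> 'a \<Rightarrow> real"
  assumes indep: "indep_vars (\<lambda>_. borel) X {1..}"
    and q: "0 \<le> q" "q < 1"
    and le: "\<And>i. i \<ge> 1 \<Longrightarrow> (\<integral>\<^sup>+\<omega>. ennreal (exp (- X i \<omega>)) \<partial>M) \<le> ennreal q"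
  shows "AE \<omega> in M. filterlim (\<lambda>n. \<Sum>i=1..n. X i \<omega>) at_top sequentially"
proof -
  define Z where "Z n \<omega> = ennreal (exp (- (\<Sum>i=1..n. X i \<omega>)))" for n \<omega>
  have meas: "X i \<in> borel_measurable M" if "i \<ge> 1" for i
    using indep that by (simp add: indep_vars_def2)
  have measZ: "Z n \<in> borel_measurable M" for n
    unfolding Z_def using meas by measurable
  have "(\<integral>\<^sup>+\<omega>. Z n \<omega> \<partial>M) \<le> ennreal (q ^ n)" for n
  proof -
    have "indep_vars (\<lambda>_. borel) (\<lambda>i \<omega>. ennreal (exp (- X i \<omega>))) {1..n}"
      by (rule indep_vars_compose2[OF indep_vars_subset[OF indep]]) auto
    then have "(\<integral>\<^sup>+\<omega>. (\<Prod>i\<in>{1..n}. ennreal (exp (- X i \<omega>))) \<partial>M) =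
        (\<Prod>i\<in>{1..n}. \<integral>\<^sup>+\<omega>. ennreal (exp (- X i \<omega>)) \<partial>M)"
      by (intro indep_vars_nn_integral) auto
    also have "\<dots> \<le> (\<Prod>i\<in>{1..n}. ennreal q)"
      using le
      by (induction n) (auto simp: power_Suc2 simp del: power_Suc intro!: mult_mono)
    also have "\<dots> = ennreal (q ^ n)"
      using q by (simp add: ennreal_power)
    finally show ?thesis
      by (simp add: Z_def prod_ennreal exp_sum flip: sum_negf)
  qed
  then have "(\<Sum>n. \<integral>\<^sup>+\<omega>. Z n \<omega> \<partial>M) \<le> (\<Sum>n. ennreal (q ^ n))"
    by (intro suminf_le) auto
  also have "\<dots> = ennreal (\<Sum>n. q ^ n)"
    using q by (intro suminf_ennreal2) (auto intro: summable_geometric)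
  finally have "(\<integral>\<^sup>+\<omega>. (\<Sum>n. Z n \<omega>) \<partial>M) \<noteq> \<infinity>"
    using measZ by (auto simp: nn_integral_suminf top_unique)
  then have "AE \<omega> in M. (\<Sum>n. Z n \<omega>) \<noteq> \<infinity>"
    using measZ by (intro nn_integral_PInf_AE) auto
  then show ?thesis
  proof eventually_elim
    case (elim \<omega>)
    have "summable (\<lambda>n. exp (- (\<Sum>i=1..n. X i \<omega>)))"
      using elim unfolding Z_def by (intro summable_suminf_not_top) auto
    then have "(\<lambda>n. exp (- (\<Sum>i=1..n. X i \<omega>))) \<longlonglongrightarrow> 0"
      by (rule summable_LIMSEQ_zero)
    then have "filterlim (\<lambda>n. exp (- (\<Sum>i=1..n. X i \<omega>))) (at_right 0) sequentially"
      by (simp add: filterlim_at)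
    then have "filterlim (\<lambda>n. ln (exp (- (\<Sum>i=1..n. X i \<omega>)))) at_bot sequentially"
      by (rule filterlim_compose[OF ln_at_0])
    then show ?case
      by (simp add: filterlim_uminus_at_top)
  qed
qed

lemma nn_integral_exp_neg_uniform:
  "(\<integral>\<^sup>+x. ennreal (exp (- x)) \<partial>uniform_measure lborel {0<..<1::real}) \<le> ennreal (1 - exp (-1))"
proof -
  have "(\<integral>\<^sup>+x. ennreal (exp (- x)) \<partial>uniform_measure lborel {0<..<1::real}) =
      (\<integral>\<^sup>+x. ennreal (exp (- x)) * indicator {0<..<1} x \<partial>lborel)"
    by (subst nn_integral_uniform_measure) (auto simp: divide_ennreal_def)
  also have "\<dots> \<le> (\<integral>\<^sup>+x. ennreal (exp (- x)) * indicator {0..1::real} x \<partial>lborel)"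
    by (intro nn_integral_mono) (auto simp: indicator_def)
  also have "\<dots> = ennreal (- exp (- 1) - (- exp (- 0)))"
    by (intro nn_integral_FTC_Icc) (auto intro!: derivative_eq_intros)
  finally show ?thesis
    by simp
qed

theorem theorem3p1:
  fixes M :: "'a measure" and X :: "nat \<Rightarrow> 'a \<Rightarrow> real" and k :: nat
  assumes "prob_space M"
    and "prob_space.indep_vars M (\<lambda>_. borel) X {1..}"
    and "\<And>i. i \<ge> 1 \<Longrightarrow> distr M borel (X i) = uniform_measure lborel {0<..<1}"
    and "k \<ge> 1"
  shows "AE \<omega> in M.
    (\<lambda>n. elem_sym k n (\<lambda>i. X i \<omega>) / (\<Sum>i=1..n. X i \<omega>) ^ k) \<longlonglongrightarrow> 1 / fact k"
proof -
  interpret prob_space M by fact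
  note indep = assms(2) and unif = assms(3)
  have meas: "X i \<in> borel_measurable M" if "i \<ge> 1" for i
    using indep that by (simp add: indep_vars_def2)
  have "AE \<omega> in M. X i \<omega> \<in> {0<..<1}" if "i \<ge> 1" for i
  proof -
    have "AE x in distr M borel (X i). x \<in> {0<..<1}"
      unfolding unif[OF that] by (rule AE_uniform_measureI) auto
    then show ?thesis
      using meas[OF that] by (subst (asm) AE_distr_iff) auto
  qed
  then have range: "AE \<omega> in M. \<forall>i. i \<ge> 1 \<longrightarrow> X i \<omega> \<in> {0<..<1}"
    by (subst AE_all_countable) simp
  have "(\<integral>\<^sup>+\<omega>. ennreal (exp (- X i \<omega>)) \<partial>M) \<le> ennreal (1 - exp (-1))" if "i \<ge> 1" for i
  proof -
    have "(\<integral>\<^sup>+\<omega>. ennreal (exp (- X i \<omega>)) \<partial>M) =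
        (\<integral>\<^sup>+x. ennreal (exp (- x)) \<partial>distr M borel (X i))"
      using meas[OF that] by (subst nn_integral_distr) auto
    then show ?thesis
      using nn_integral_exp_neg_uniform by (simp add: unif[OF that])
  qed
  then have "AE \<omega> in M. filterlim (\<lambda>n. \<Sum>i=1..n. X i \<omega>) at_top sequentially"
    by (intro AE_sum_indep_at_top[OF indep, where q = "1 - exp (-1)"]) auto
  with range show ?thesis
  proof eventually_elim
    case (elim \<omega>)
    then have "0 \<le> X i \<omega>" "X i \<omega> \<le> 1" if "i \<ge> 1" for i
      using that by (simp_all add: less_imp_le)
    then show ?case
      using elim(2) by (intro elem_sym_div_sum_power_tendsto) auto
  qed
qed

end
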